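(* Let $\sigma_1<0$, $\sigma_2\in(0,1)$ and $\sigma_3\ge 1$ be real, and for $t>0$ let $$S_B=\sum_{m_1=1}^{[t]}\sum_{m_2=1}^{[t]}\frac{1}{(m_1+m_2)^{\sigma_1+it}}\,\frac{1}{m_2^{\sigma_2-it}}\,\frac{1}{m_1^{\sigma_3}}.$$ Then, as $t\to\infty$, $$|S_B|=\begin{cases}O\left(t^{1-\sigma_1-\sigma_2}\ln t\right), & 0<\sigma_2<\frac12,\ \sigma_3=1,\\[1mm] O\left(t^{1-\sigma_1-\sigma_2}\right), & 0<\sigma_2<\frac12,\ \sigma_3>1,\\[1mm] O\left(t^{\frac12-\sigma_1}\ln t\right), & \frac12\le\sigma_2<1,\ \sigma_3\ge 1.\end{cases}$$
   Context: $[A]$ denotes the integer part of $A$. The parameters $\sigma_1,\sigma_2,\sigma_3$ are fixed, and the $O$-statements are for real $t\to\infty$ (implied constants may depend on $\sigma_1,\sigma_2,\sigma_3$). *)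

theory Defs
  imports "HOL-Analysis.Analysis" "HOL-Library.Landau_Symbols"
begin

definition S_B :: "real \<Rightarrow> real \<Rightarrow> real \<Rightarrow> real \<Rightarrow> complex" where
  "S_B \<sigma>\<^sub>1 \<sigma>\<^sub>2 \<sigma>\<^sub>3 t =
     (\<Sum>m\<^sub>1 = 1..nat \<lfloor>t\<rfloor>. \<Sum>m\<^sub>2 = 1..nat \<lfloor>t\<rfloor>.
        1 / of_nat (m\<^sub>1 + m\<^sub>2) powr (of_real \<sigma>\<^sub>1 + \<i> * of_real t)
      * (1 / of_nat m\<^sub>2 powr (of_real \<sigma>\<^sub>2 - \<i> * of_real t))
      * (1 / of_nat m\<^sub>1 powr of_real \<sigma>\<^sub>3))"

end

theory Submission
  imports Defs
begin

text \<open>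
  The oscillating factors play no role. Since \<open>\<sigma>\<^sub>1 < 0\<close>, each \<open>(m\<^sub>1 + m\<^sub>2)\<^bsup>-\<sigma>\<^sub>1\<^esup>\<close> is at most
  \<open>(2t)\<^bsup>-\<sigma>\<^sub>1\<^esup>\<close>, and the double sum factors into \<open>\<Sum> m\<^sub>2\<^bsup>-\<sigma>\<^sub>2\<^esup> = O(t\<^bsup>1 - \<sigma>\<^sub>2\<^esup>)\<close> and
  \<open>\<Sum> m\<^sub>1\<^bsup>-\<sigma>\<^sub>3\<^esup>\<close>, which is \<open>O(ln t)\<close> in general and bounded when \<open>\<sigma>\<^sub>3 > 1\<close>. In the range
  \<open>\<sigma>\<^sub>2 \<ge> 1/2\<close> the claimed bound is weaker than this one.
\<close>

lemma powr_diff_ge_deriv: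
  fixes a x y :: real
  assumes "0 < a" "a < 1" "0 \<le> x" "x < y"
  shows "a * y powr (a - 1) * (y - x) \<le> y powr a - x powr a"
proof -
  have "\<exists>l z. x < z \<and> z < y \<and> DERIV (\<lambda>u. u powr a) z :> l \<and> y powr a - x powr a = (y - x) * l"
  proof (rule MVT)
    show "continuous_on {x..y} (\<lambda>u. u powr a)"
      using assms by (intro continuous_on_powr') (auto intro!: continuous_intros)
    show "(\<lambda>u. u powr a) differentiable (at u)" if "x < u" "u < y" for u
      using that assms by (auto intro!: derivative_eq_intros simp: real_differentiable_def)
  qed (use assms in auto)
  then obtain l z where z: "x < z" "z < y" "DERIV (\<lambda>u. u powr a) z :> l"
    "y powr a - x powr a = (y - x) * l" by blast
  have "DERIV (\<lambda>u. u powr a) z :> a * z powr (a - 1)"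
    using z assms by (auto intro!: derivative_eq_intros)
  with z(3) have l: "l = a * z powr (a - 1)"
    by (rule DERIV_unique)
  have "y powr (a - 1) \<le> z powr (a - 1)"
    using z assms by (intro powr_mono2') auto
  then show ?thesis
    using z assms by (auto simp: l mult_ac intro!: mult_left_mono)
qed

text \<open>Each term is at most an increment of \<open>u powr (1 - s) / (1 - s)\<close> over a unit
  interval, and these increments telescope from 0.\<close>

lemma sum_powr_minus_le:
  fixes s :: real
  assumes "0 < s" "s < 1"
  shows "(\<Sum>m=1..n. real m powr - s) \<le> real n powr (1 - s) / (1 - s)"
proof (induction n)
  case (Suc n)
  have "(1 - s) * real (Suc n) powr - s \<le> real (Suc n) powr (1 - s) - real n powr (1 - s)"
    using powr_diff_ge_deriv[of "1 - s" "real n" "real (Suc n)"] assms by simp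
  then have "real (Suc n) powr - s \<le> (real (Suc n) powr (1 - s) - real n powr (1 - s)) / (1 - s)"
    using assms by (simp add: field_simps)
  with Suc show ?case
    by (simp add: diff_divide_distrib)
qed simp

text \<open>The factor \<open>2 powr - \<sigma>\<^sub>1\<close> comes from
  \<open>m\<^sub>1 + m\<^sub>2 \<le> 2 * t\<close>, and \<open>1 / (1 - \<sigma>\<^sub>2)\<close>
  from the sum over \<open>m\<^sub>2\<close>. The sum over \<open>m\<^sub>1\<close> is left
  unevaluated, so that all cases of \<open>\<sigma>\<^sub>3\<close> share this bound.\<close>

lemma cmod_S_B_le:
  assumes "\<sigma>\<^sub>1 < 0" "0 < \<sigma>\<^sub>2" "\<sigma>\<^sub>2 < 1" "1 \<le> t"
  shows "cmod (S_B \<sigma>\<^sub>1 \<sigma>\<^sub>2 \<sigma>\<^sub>3 t) \<le>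
           2 powr - \<sigma>\<^sub>1 / (1 - \<sigma>\<^sub>2) * t powr (1 - \<sigma>\<^sub>1 - \<sigma>\<^sub>2) * (\<Sum>m=1..nat \<lfloor>t\<rfloor>. real m powr - \<sigma>\<^sub>3)"
proof -
  define N where "N = nat \<lfloor>t\<rfloor>"
  have Nt: "real N \<le> t"
    using assms by (simp add: N_def)
  let ?A = "\<Sum>m=1..N. real m powr - \<sigma>\<^sub>3"
  let ?B = "\<Sum>m=1..N. real m powr - \<sigma>\<^sub>2"
  have "cmod (S_B \<sigma>\<^sub>1 \<sigma>\<^sub>2 \<sigma>\<^sub>3 t) \<le>
      (\<Sum>m\<^sub>1=1..N. \<Sum>m\<^sub>2=1..N. (2 * t) powr - \<sigma>\<^sub>1 * real m\<^sub>2 powr - \<sigma>\<^sub>2 * real m\<^sub>1 powr - \<sigma>\<^sub>3)"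
    unfolding S_B_def N_def[symmetric]
  proof (intro order.trans[OF norm_sum] sum_mono)
    fix m\<^sub>1 m\<^sub>2 assume m: "m\<^sub>1 \<in> {1..N}" "m\<^sub>2 \<in> {1..N}"
    \<comment> \<open>The base is a nonnegative real, so imaginary parts of exponents only affect
      the phase. For \<open>k = 0\<close> both sides are 0.\<close>
    have n: "cmod (1 / of_nat k powr z) = real k powr - Re z" for k z
      by (simp add: norm_divide norm_powr_real_powr powr_minus_divide)
    have "real (m\<^sub>1 + m\<^sub>2) \<le> 2 * t"
      using m Nt by auto
    then have "real (m\<^sub>1 + m\<^sub>2) powr - \<sigma>\<^sub>1 \<le> (2 * t) powr - \<sigma>\<^sub>1"
      using assms by (intro powr_mono2) auto
    then show "cmod (1 / of_nat (m\<^sub>1 + m\<^sub>2) powr (of_real \<sigma>\<^sub>1 + \<i> * of_real t)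
        * (1 / of_nat m\<^sub>2 powr (of_real \<sigma>\<^sub>2 - \<i> * of_real t)) * (1 / of_nat m\<^sub>1 powr of_real \<sigma>\<^sub>3))
      \<le> (2 * t) powr - \<sigma>\<^sub>1 * real m\<^sub>2 powr - \<sigma>\<^sub>2 * real m\<^sub>1 powr - \<sigma>\<^sub>3"
      unfolding norm_mult n by (intro mult_mono) auto
  qed
  also have "\<dots> = (2 * t) powr - \<sigma>\<^sub>1 * ?B * ?A"
    by (simp flip: sum_distrib_left sum_distrib_right)
  also have "\<dots> \<le> (2 * t) powr - \<sigma>\<^sub>1 * (t powr (1 - \<sigma>\<^sub>2) / (1 - \<sigma>\<^sub>2)) * ?A"
  proof (intro mult_right_mono mult_left_mono sum_nonneg)
    have "?B \<le> real N powr (1 - \<sigma>\<^sub>2) / (1 - \<sigma>\<^sub>2)"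
      using assms by (intro sum_powr_minus_le) auto
    also have "\<dots> \<le> t powr (1 - \<sigma>\<^sub>2) / (1 - \<sigma>\<^sub>2)"
      using assms Nt by (intro divide_right_mono powr_mono2) auto
    finally show "?B \<le> t powr (1 - \<sigma>\<^sub>2) / (1 - \<sigma>\<^sub>2)" .
  qed auto
  also have "(2 * t) powr - \<sigma>\<^sub>1 * (t powr (1 - \<sigma>\<^sub>2) / (1 - \<sigma>\<^sub>2)) =
      2 powr - \<sigma>\<^sub>1 / (1 - \<sigma>\<^sub>2) * t powr (1 - \<sigma>\<^sub>1 - \<sigma>\<^sub>2)"
  proof -
    have "t powr (1 - \<sigma>\<^sub>1 - \<sigma>\<^sub>2) = t powr - \<sigma>\<^sub>1 * t powr (1 - \<sigma>\<^sub>2)"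
      by (simp flip: powr_add add: algebra_simps)
    then show ?thesis
      using assms by (simp add: powr_mult)
  qed
  finally show ?thesis
    by (simp add: N_def)
qed

text \<open>Reduces each case of the theorem to the growth \<open>g\<close> of the sum over
  \<open>m\<^sub>1\<close>.\<close>

lemma S_B_bigo:
  assumes "\<sigma>\<^sub>1 < 0" "0 < \<sigma>\<^sub>2" "\<sigma>\<^sub>2 < 1"
    and "(\<lambda>t. \<Sum>m=1..nat \<lfloor>t\<rfloor>. real m powr - \<sigma>\<^sub>3) \<in> O[at_top](g)"
  shows "(\<lambda>t. cmod (S_B \<sigma>\<^sub>1 \<sigma>\<^sub>2 \<sigma>\<^sub>3 t)) \<in> O[at_top](\<lambda>t. t powr (1 - \<sigma>\<^sub>1 - \<sigma>\<^sub>2) * g t)"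
proof -
  have "(\<lambda>t. cmod (S_B \<sigma>\<^sub>1 \<sigma>\<^sub>2 \<sigma>\<^sub>3 t)) \<in>
      O[at_top](\<lambda>t. t powr (1 - \<sigma>\<^sub>1 - \<sigma>\<^sub>2) * (\<Sum>m=1..nat \<lfloor>t\<rfloor>. real m powr - \<sigma>\<^sub>3))"
  proof (rule bigoI)
    show "\<forall>\<^sub>F t in at_top. norm (cmod (S_B \<sigma>\<^sub>1 \<sigma>\<^sub>2 \<sigma>\<^sub>3 t)) \<le> 2 powr - \<sigma>\<^sub>1 / (1 - \<sigma>\<^sub>2) *
        norm (t powr (1 - \<sigma>\<^sub>1 - \<sigma>\<^sub>2) * (\<Sum>m=1..nat \<lfloor>t\<rfloor>. real m powr - \<sigma>\<^sub>3))"
      using eventually_ge_at_top[of 1]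
    proof eventually_elim
      case (elim t)
      have "0 \<le> (\<Sum>m=1..nat \<lfloor>t\<rfloor>. real m powr - \<sigma>\<^sub>3)"
        by (intro sum_nonneg) auto
      then show ?case
        using cmod_S_B_le[of \<sigma>\<^sub>1 \<sigma>\<^sub>2 t \<sigma>\<^sub>3] assms elim by (simp add: abs_mult mult_ac)
    qed
  qed
  also have "(\<lambda>t. t powr (1 - \<sigma>\<^sub>1 - \<sigma>\<^sub>2) * (\<Sum>m=1..nat \<lfloor>t\<rfloor>. real m powr - \<sigma>\<^sub>3)) \<in>
      O[at_top](\<lambda>t. t powr (1 - \<sigma>\<^sub>1 - \<sigma>\<^sub>2) * g t)"
    using assms(4) by (intro landau_o.big.mult) auto
  finally show ?thesis .
qed

text \<open>The sequence \<open>harm n - ln n\<close> is decreasing and equals 1 at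
  \<open>n = 1\<close>.\<close>

lemma sum_inverse_le_ln: "0 < n \<Longrightarrow> (\<Sum>m=1..n. inverse (real m)) \<le> 1 + ln (real n)"
  using euler_mascheroni_sequence_decreasing[of 1 n] by (simp add: harm_def)

lemma sum_powr_minus_bigo_ln:
  fixes s :: real
  assumes "1 \<le> s"
  shows "(\<lambda>t :: real. \<Sum>m=1..nat \<lfloor>t\<rfloor>. real m powr - s) \<in> O[at_top](\<lambda>t. ln t)"
proof (rule bigoI)
  show "\<forall>\<^sub>F t :: real in at_top. norm (\<Sum>m=1..nat \<lfloor>t\<rfloor>. real m powr - s) \<le> 2 * norm (ln t)"
    \<comment> \<open>From \<open>exp 1\<close> on, \<open>1 \<le> ln t\<close>, so
      \<open>1 + ln t\<close> is at most \<open>2 * ln t\<close>; hence the constant 2.\<close>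
    using eventually_ge_at_top[of "exp 1"]
  proof eventually_elim
    case (elim t)
    have "1 < t"
      using elim exp_gt_one[of "1 :: real"] by linarith
    have "1 \<le> ln t"
      using elim \<open>1 < t\<close> by (simp add: ln_ge_iff)
    have "(\<Sum>m=1..nat \<lfloor>t\<rfloor>. real m powr - s) \<le> (\<Sum>m=1..nat \<lfloor>t\<rfloor>. inverse (real m))"
    proof (rule sum_mono)
      fix m assume "m \<in> {1..nat \<lfloor>t\<rfloor>}"
      then have "real m powr - s \<le> real m powr - 1"
        using assms by (intro powr_mono) auto
      then show "real m powr - s \<le> inverse (real m)"
        by (simp add: powr_minus)
    qed
    also have "\<dots> \<le> 1 + ln (real (nat \<lfloor>t\<rfloor>))"
      using \<open>1 < t\<close> by (intro sum_inverse_le_ln) linarith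
    also have "\<dots> \<le> 1 + ln t"
      using \<open>1 < t\<close> by (intro add_left_mono ln_mono) linarith+
    finally show ?case
      using \<open>1 \<le> ln t\<close> by (simp add: abs_of_nonneg sum_nonneg)
  qed
qed

text \<open>The terms are nonnegative, so the convergent full series serves as the constant; its
  term at \<open>m = 0\<close> is 0.\<close>

lemma sum_powr_minus_bigo_1:
  fixes s :: real
  assumes "1 < s"
  shows "(\<lambda>t :: real. \<Sum>m=1..nat \<lfloor>t\<rfloor>. real m powr - s) \<in> O[at_top](\<lambda>t. 1)"
proof (rule bigoI, rule always_eventually, rule allI)
  fix t :: real
  have "(\<Sum>m=1..nat \<lfloor>t\<rfloor>. real m powr - s) \<le> (\<Sum>m. real m powr - s)"
    using assms by (intro sum_le_suminf) (auto simp: summable_real_powr_iff)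
  then show "norm (\<Sum>m=1..nat \<lfloor>t\<rfloor>. real m powr - s) \<le> (\<Sum>m. real m powr - s) * norm (1 :: real)"
    by (simp add: abs_of_nonneg sum_nonneg)
qed

theorem lemma4p2:
  fixes \<sigma>\<^sub>1 \<sigma>\<^sub>2 \<sigma>\<^sub>3 :: real
  assumes "\<sigma>\<^sub>1 < 0" and "0 < \<sigma>\<^sub>2" and "\<sigma>\<^sub>2 < 1" and "\<sigma>\<^sub>3 \<ge> 1"
  shows "(\<sigma>\<^sub>2 < 1/2 \<and> \<sigma>\<^sub>3 = 1 \<longrightarrow>
            (\<lambda>t. cmod (S_B \<sigma>\<^sub>1 \<sigma>\<^sub>2 \<sigma>\<^sub>3 t)) \<in> O[at_top](\<lambda>t. t powr (1 - \<sigma>\<^sub>1 - \<sigma>\<^sub>2) * ln t))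
       \<and> (\<sigma>\<^sub>2 < 1/2 \<and> \<sigma>\<^sub>3 > 1 \<longrightarrow>
            (\<lambda>t. cmod (S_B \<sigma>\<^sub>1 \<sigma>\<^sub>2 \<sigma>\<^sub>3 t)) \<in> O[at_top](\<lambda>t. t powr (1 - \<sigma>\<^sub>1 - \<sigma>\<^sub>2)))
       \<and> (1/2 \<le> \<sigma>\<^sub>2 \<longrightarrow>
            (\<lambda>t. cmod (S_B \<sigma>\<^sub>1 \<sigma>\<^sub>2 \<sigma>\<^sub>3 t)) \<in> O[at_top](\<lambda>t. t powr (1/2 - \<sigma>\<^sub>1) * ln t))"
proof (intro conjI impI)
  \<comment> \<open>This holds for every \<open>\<sigma>\<^sub>3 \<ge> 1\<close> and yields both the
    first and the third case.\<close>
  have log_bound: "(\<lambda>t. cmod (S_B \<sigma>\<^sub>1 \<sigma>\<^sub>2 \<sigma>\<^sub>3 t)) \<in> O[at_top](\<lambda>t. t powr (1 - \<sigma>\<^sub>1 - \<sigma>\<^sub>2) * ln t)"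
    using assms by (intro S_B_bigo sum_powr_minus_bigo_ln)
  then show "(\<lambda>t. cmod (S_B \<sigma>\<^sub>1 \<sigma>\<^sub>2 \<sigma>\<^sub>3 t)) \<in> O[at_top](\<lambda>t. t powr (1 - \<sigma>\<^sub>1 - \<sigma>\<^sub>2) * ln t)" .
  show "(\<lambda>t. cmod (S_B \<sigma>\<^sub>1 \<sigma>\<^sub>2 \<sigma>\<^sub>3 t)) \<in> O[at_top](\<lambda>t. t powr (1 - \<sigma>\<^sub>1 - \<sigma>\<^sub>2))"
    if "\<sigma>\<^sub>2 < 1/2 \<and> \<sigma>\<^sub>3 > 1"
    using S_B_bigo[OF assms(1-3) sum_powr_minus_bigo_1] that by simp
  show "(\<lambda>t. cmod (S_B \<sigma>\<^sub>1 \<sigma>\<^sub>2 \<sigma>\<^sub>3 t)) \<in> O[at_top](\<lambda>t. t powr (1/2 - \<sigma>\<^sub>1) * ln t)"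
    if "1/2 \<le> \<sigma>\<^sub>2"
  proof -
    \<comment> \<open>For \<open>1/2 \<le> \<sigma>\<^sub>2\<close> the left exponent is at most the
      right one, and powers with base \<open>t \<ge> 1\<close> increase with the exponent.\<close>
    have "(\<lambda>t. t powr (1 - \<sigma>\<^sub>1 - \<sigma>\<^sub>2)) \<in> O[at_top](\<lambda>t :: real. t powr (1/2 - \<sigma>\<^sub>1))"
    proof (rule bigoI)
      show "\<forall>\<^sub>F t :: real in at_top. norm (t powr (1 - \<sigma>\<^sub>1 - \<sigma>\<^sub>2)) \<le> 1 * norm (t powr (1/2 - \<sigma>\<^sub>1))"
        using eventually_ge_at_top[of 1] by eventually_elim (use that in \<open>auto intro!: powr_mono\<close>)
    qed
    then have "(\<lambda>t. t powr (1 - \<sigma>\<^sub>1 - \<sigma>\<^sub>2) * ln t) \<in> O[at_top](\<lambda>t. t powr (1/2 - \<sigma>\<^sub>1) * ln t)"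
      by (intro landau_o.big.mult) auto
    with log_bound show ?thesis
      by (rule landau_o.big_trans)
  qed
qed

end
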